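(* Let $q$ be a power of a prime $p$ and let $K$ be an algebraic closure of $\mathbb{F}_q$. Let $\mathrm{AGL}(2,q)$ denote the stabilizer in $\mathrm{PGL}(3,q)$ of the line $Z=0$, acting on $\mathrm{PG}(2,K)$. Then $d(\mathrm{AGL}(2,q))=q^3-q^2$; that is, every $\mathrm{AGL}(2,q)$-invariant irreducible plane curve over $K$ other than a line has degree at least $q^3-q^2$, and there exists an $\mathrm{AGL}(2,q)$-invariant irreducible plane curve of degree $q^3-q^2$.
   Context: A plane curve is a projective plane curve $F(X,Y,Z)=0$ over $K$; it is irreducible if $F$ is irreducible over $K$. For a subgroup $G\le \mathrm{PGL}(3,K)$, a curve is $G$-invariant if every element of $G$ maps it onto itself. $d(G)$ denotes the smallest degree of a $G$-invariant irreducible plane curve other than a line. *)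

theory Defs
  imports "HOL-Computational_Algebra.Computational_Algebra"
begin

text \<open>Trivariate polynomials K[X,Y,Z] are modelled as nested univariate polynomials
  ((K[X])[Y])[Z], i.e. the type 'k poly poly poly. The coefficient of X^i Y^j Z^k in F
  is coeff (coeff (coeff F k) j) i.\<close>

type_synonym 'k poly3 = "'k poly poly poly"

definition const3 :: "'k::comm_ring_1 \<Rightarrow> 'k poly3" where
  "const3 c = [:[:[:c:]:]:]"

definition varX :: "'k::comm_ring_1 poly3" where "varX = [:[:[:0, 1:]:]:]"
definition varY :: "'k::comm_ring_1 poly3" where "varY = [:[:0, 1:]:]"
definition varZ :: "'k::comm_ring_1 poly3" where "varZ = [:0, 1:]"

definition subst3 :: "'k::comm_ring_1 poly3 \<Rightarrow> 'k poly3 \<Rightarrow> 'k poly3 \<Rightarrow> 'k poly3 \<Rightarrow> 'k poly3" where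
  "subst3 F u v w =
     poly (map_poly (\<lambda>G. poly (map_poly (\<lambda>H. poly (map_poly const3 H) u) G) v) F) w"

definition plane_curve :: "nat \<Rightarrow> 'k::comm_ring_1 poly3 \<Rightarrow> bool" where
  "plane_curve d F \<longleftrightarrow> F \<noteq> 0 \<and> d \<ge> 1 \<and>
     (\<forall>i j k. coeff (coeff (coeff F k) j) i \<noteq> 0 \<longrightarrow> i + j + k = d)"

definition in_Fq :: "nat \<Rightarrow> 'k::field \<Rightarrow> bool" where
  "in_Fq q x \<longleftrightarrow> x ^ q = x"

definition det3 :: "(nat \<Rightarrow> nat \<Rightarrow> 'k::comm_ring_1) \<Rightarrow> 'k" where
  "det3 M = M 0 0 * (M 1 1 * M 2 2 - M 1 2 * M 2 1)
          - M 0 1 * (M 1 0 * M 2 2 - M 1 2 * M 2 0)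
          + M 0 2 * (M 1 0 * M 2 1 - M 1 1 * M 2 0)"

text \<open>Matrices representing elements of AGL(2,q): invertible 3x3 matrices over F_q
  (acting on column vectors (X,Y,Z)) mapping the line Z = 0 onto itself.\<close>
definition AGL_mat :: "nat \<Rightarrow> (nat \<Rightarrow> nat \<Rightarrow> 'k::field) \<Rightarrow> bool" where
  "AGL_mat q M \<longleftrightarrow> (\<forall>i<3. \<forall>j<3. in_Fq q (M i j)) \<and> det3 M \<noteq> 0 \<and> M 2 0 = 0 \<and> M 2 1 = 0"

definition lin_subst :: "(nat \<Rightarrow> nat \<Rightarrow> 'k::comm_ring_1) \<Rightarrow> 'k poly3 \<Rightarrow> 'k poly3" where
  "lin_subst M F = subst3 F
     (const3 (M 0 0) * varX + const3 (M 0 1) * varY + const3 (M 0 2) * varZ)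
     (const3 (M 1 0) * varX + const3 (M 1 1) * varY + const3 (M 1 2) * varZ)
     (const3 (M 2 0) * varX + const3 (M 2 1) * varY + const3 (M 2 2) * varZ)"

definition AGL_invariant :: "nat \<Rightarrow> 'k::field poly3 \<Rightarrow> bool" where
  "AGL_invariant q F \<longleftrightarrow>
     (\<forall>M. AGL_mat q M \<longrightarrow> (\<exists>c. c \<noteq> 0 \<and> lin_subst M F = const3 c * F))"

end

theory Submission
  imports Defs
begin

text \<open>
  Lower bound. Put \<open>Z = 1\<close> and let \<open>f(x,y)\<close> be the affine equation. Invariance under
  \<open>y \<mapsto> y + a + bx\<close> with \<open>a, b \<in> F\<^sub>q\<close> forces \<open>f = G(N)\<close> for a polynomial \<open>G\<close> over \<open>K[x]\<close>,
  where \<open>N = \<Prod>(y - a - bx)\<close> has degree \<open>q\<^sup>2\<close>. If \<open>deg f < q\<^sup>3 - q\<^sup>2\<close> then \<open>deg G < q - 1\<close>, and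
  the torus \<open>y \<mapsto> \<delta>y\<close> leaves \<open>G\<close> only one monomial \<open>g N\<^sup>k\<close>. Either \<open>k > 0\<close> and \<open>y\<close> divides \<open>f\<close>,
  or \<open>f = g(x)\<close>, which \<open>x \<mapsto> x + y\<close> forces to be constant.

  Existence. Let \<open>Q\<close> be the Dickson invariant of degree \<open>q\<^sup>2 - q\<close> of \<open>GL(2,q)\<close>, and take
  \<open>f = Q(x^q - x, y^q - y) + 1\<close>. Then \<open>f - 1\<close> vanishes on the \<open>q\<^sup>2 - q\<close> curves
  \<open>E\<^sub>b: y^q - y = b (x^q - x)\<close> with \<open>b \<in> F\<^bsub>q\<^sup>2\<^esub> - F\<^sub>q\<close>. In the coordinates \<open>s = y - bx\<close>,
  \<open>t = y - b^q x\<close> the curve \<open>E\<^sub>b\<close> is the graph \<open>s = t^q\<close>, so its coordinate ring is \<open>K[t]\<close>. If \<open>f = P R\<close>,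
  then \<open>P\<close> is a unit, that is a constant, on every \<open>E\<^sub>b\<close>; all the \<open>E\<^sub>b\<close> pass through the origin, so this
  constant is \<open>P(0,0)\<close>. Hence \<open>\<Prod>E\<^sub>b\<close>, of the same degree as \<open>f\<close>, divides \<open>P - P(0,0)\<close>,
  so \<open>P\<close> or \<open>R\<close> is constant.
\<close>

section \<open>Evaluation homomorphisms\<close>

text \<open>Evaluation, composition and restriction to a curve are all ring homomorphisms; two of
  them agree as soon as they agree on constants and variables.\<close>

locale unital_hom =
  fixes h :: "'a::comm_ring_1 \<Rightarrow> 'b::comm_ring_1"
  assumes one [simp]: "h 1 = 1"
    and add [simp]: "h (x + y) = h x + h y"
    and mult [simp]: "h (x * y) = h x * h y"
begin

lemma zero [simp]: "h 0 = 0"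
  using add[of 0 0] by simp

lemma uminus [simp]: "h (- x) = - h x"
  using add[of "- x" x] by (simp add: eq_neg_iff_add_eq_0 del: add)

lemma diff [simp]: "h (x - y) = h x - h y"
  using add[of x "- y"] by (simp del: add)

lemma power [simp]: "h (x ^ n) = h x ^ n"
  by (induction n) simp_all

lemma unit: "x dvd 1 \<Longrightarrow> h x dvd 1"
  by (metis dvdE dvdI mult one)

lemma eval_pCons [simp]:
  "poly (map_poly h (pCons c p)) a = h c + a * poly (map_poly h p) a"
  by (simp add: map_poly_pCons)

lemma eval: "unital_hom (\<lambda>p. poly (map_poly h p) a)"
proof
  show "poly (map_poly h (p + q)) a = poly (map_poly h p) a + poly (map_poly h q) a" for p q
    by (induction p q rule: poly_induct2) (simp_all add: algebra_simps)
  have smult: "poly (map_poly h (smult c p)) a = h c * poly (map_poly h p) a" for c p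
    by (induction p) (simp_all add: algebra_simps)
  show "poly (map_poly h (p * q)) a = poly (map_poly h p) a * poly (map_poly h q) a" for p q
  proof (induction p)
    case (pCons c p)
    have "poly (map_poly h (pCons c p * q)) a
        = poly (map_poly h (smult c q)) a + poly (map_poly h (pCons 0 (p * q))) a"
      by (simp add: \<open>\<And>p q. poly (map_poly h (p + q)) a = _\<close>)
    then show ?case
      by (simp add: smult pCons.IH algebra_simps)
  qed simp
qed simp

end

lemma unital_hom_poly: "unital_hom (\<lambda>p. poly p a)"
  by unfold_locales simp_all

lemma unital_hom_pcompose: "unital_hom (\<lambda>p. pcompose p q)"
  by unfold_locales (simp_all add: pcompose_add pcompose_mult pcompose_1)

lemma unital_hom_const: "unital_hom (\<lambda>c. [:c:])"
  by unfold_locales (simp_all flip: one_pCons)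

lemma unital_hom_comp: "unital_hom f \<Longrightarrow> unital_hom g \<Longrightarrow> unital_hom (\<lambda>x. f (g x))"
  by (simp add: unital_hom_def)

lemma unital_hom_const2: "unital_hom (\<lambda>c. [:[:c:]:])"
  by (intro unital_hom_comp[OF unital_hom_const] unital_hom_const)

lemma unital_hom_const3: "unital_hom const3"
  unfolding const3_def[abs_def]
  by (intro unital_hom_comp[OF unital_hom_const] unital_hom_const2)

lemma unital_hom_poly_eqI:
  assumes "unital_hom f" "unital_hom g" "\<And>c. f [:c:] = g [:c:]" "f [:0, 1:] = g [:0, 1:]"
  shows "f p = g p"
proof (induction p)
  case 0
  then show ?case
    using assms(1,2) by (simp add: unital_hom.zero)
next
  case (pCons c p)
  have *: "pCons c p = [:c:] + [:0, 1:] * p"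
    by simp
  show ?case
    unfolding * using assms pCons by (simp only: unital_hom.add unital_hom.mult)
qed

text \<open>The coefficient map \<open>h\<close> is a parameter because values are taken in
  different rings: \<open>K[x,y]\<close> for affine maps, \<open>K[t]\<close> on a parametrised
  curve.\<close>

definition eval2 :: "('k::comm_ring_1 \<Rightarrow> 'a::comm_ring_1) \<Rightarrow> 'a \<Rightarrow> 'a \<Rightarrow> 'k poly poly \<Rightarrow> 'a" where
  "eval2 h u v G = poly (map_poly (\<lambda>H. poly (map_poly h H) u) G) v"

lemma subst3_eval2: "subst3 F u v w = poly (map_poly (eval2 const3 u v) F) w"
  by (simp add: subst3_def eval2_def[abs_def])

lemma unital_hom_eval2: "unital_hom h \<Longrightarrow> unital_hom (eval2 h u v)"
  unfolding eval2_def[abs_def] by (intro unital_hom.eval)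

lemma eval2_gens [simp]:
  assumes "unital_hom h"
  shows "eval2 h u v [:[:c:]:] = h c" "eval2 h u v [:[:0, 1:]:] = u" "eval2 h u v [:0, 1:] = v"
proof -
  interpret h: unital_hom h by fact
  interpret e: unital_hom "\<lambda>H. poly (map_poly h H) u" by (rule h.eval)
  show "eval2 h u v [:[:c:]:] = h c" "eval2 h u v [:[:0, 1:]:] = u" "eval2 h u v [:0, 1:] = v"
    by (simp_all add: eval2_def)
qed

lemma unital_hom_poly2_eqI:
  assumes "unital_hom f" "unital_hom g" "\<And>c. f [:[:c:]:] = g [:[:c:]:]"
    "f [:[:0, 1:]:] = g [:[:0, 1:]:]" "f [:0, 1:] = g [:0, 1:]"
  shows "f p = g p"
proof (rule unital_hom_poly_eqI[OF assms(1,2) _ assms(5)])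
  fix c :: "'a poly"
  show "f [:c:] = g [:c:]"
    by (rule unital_hom_poly_eqI[of "\<lambda>c. f [:c:]" "\<lambda>c. g [:c:]"])
       (use assms in \<open>auto intro: unital_hom_comp[OF _ unital_hom_const]\<close>)
qed

lemma unital_hom_subst3: "unital_hom (\<lambda>F. subst3 F u v w)"
  unfolding subst3_eval2 by (intro unital_hom.eval unital_hom_eval2 unital_hom_const3)

lemma subst3_gens [simp]:
  "subst3 (const3 c) u v w = const3 c" "subst3 varX u v w = u"
  "subst3 varY u v w = v" "subst3 varZ u v w = w"
proof -
  interpret unital_hom "eval2 const3 u v"
    by (intro unital_hom_eval2 unital_hom_const3)
  show "subst3 (const3 c) u v w = const3 c" "subst3 varX u v w = u"
    "subst3 varY u v w = v" "subst3 varZ u v w = w"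
    by (simp_all add: subst3_eval2 varX_def varY_def varZ_def
        eval2_gens[OF unital_hom_const3] const3_def[of c, symmetric])
       (simp_all add: const3_def eval2_gens[OF unital_hom_const3])
qed

lemma unital_hom_poly3_eqI:
  fixes f g :: "'k::comm_ring_1 poly3 \<Rightarrow> 'a::comm_ring_1"
  assumes "unital_hom f" "unital_hom g" "\<And>c. f (const3 c) = g (const3 c)"
    "f varX = g varX" "f varY = g varY" "f varZ = g varZ"
  shows "f p = g p"
proof (rule unital_hom_poly_eqI[OF assms(1,2) _ assms(6)[unfolded varZ_def]])
  fix c :: "'k poly poly"
  show "f [:c:] = g [:c:]"
    by (rule unital_hom_poly2_eqI[of "\<lambda>c. f [:c:]" "\<lambda>c. g [:c:]"])
       (use assms in \<open>auto simp: varX_def varY_def const3_def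
         intro: unital_hom_comp[OF _ unital_hom_const]\<close>)
qed

text \<open>Both sides are homomorphisms in \<open>F\<close>, so the variables decide. This turns
  the action of a matrix into an affine substitution.\<close>

lemma poly_subst3_1:
  assumes "poly w 1 = 1"
  shows "poly (subst3 F u v w) 1 = eval2 (\<lambda>c. [:[:c:]:]) (poly u 1) (poly v 1) (poly F 1)"
  by (rule unital_hom_poly3_eqI[of "\<lambda>F. poly (subst3 F u v w) 1"
        "\<lambda>F. eval2 (\<lambda>c. [:[:c:]:]) (poly u 1) (poly v 1) (poly F 1)"])
     (auto intro!: unital_hom_comp[OF unital_hom_poly unital_hom_subst3]
        unital_hom_comp[OF unital_hom_eval2 unital_hom_poly] unital_hom_const2
        simp: assms, auto simp: const3_def varX_def varY_def varZ_def unital_hom_const2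
        unital_hom.one[OF unital_hom_eval2])

text \<open>A substitution that fixes \<open>x\<close> is a composition in \<open>y\<close> over
  \<open>K[x]\<close>, so univariate arguments apply to it.\<close>

lemma eval2_pcompose: "eval2 (\<lambda>c. [:[:c:]:]) [:[:0, 1:]:] v f = pcompose f v"
  by (rule unital_hom_poly2_eqI[of "eval2 _ _ _" "\<lambda>f. pcompose f v"])
     (auto intro!: unital_hom_eval2 unital_hom_const2 unital_hom_pcompose
        simp: unital_hom_const2 pcompose_pCons)

text \<open>Horner's rule modulo \<open>d\<close>. It serves to replace coordinates by congruent
  ones modulo the equation of a curve.\<close>

lemma dvd_eval_diff:
  fixes a a' d :: "'b::comm_ring_1"
  assumes "unital_hom h" "unital_hom h'" "d dvd a - a'" "\<And>c. d dvd h c - h' c"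
  shows "d dvd poly (map_poly h p) a - poly (map_poly h' p) a'"
proof (induction p)
  case (pCons c p)
  have *: "poly (map_poly h (pCons c p)) a - poly (map_poly h' (pCons c p)) a'
      = (h c - h' c) + (a - a') * poly (map_poly h p) a
        + a' * (poly (map_poly h p) a - poly (map_poly h' p) a')"
    using assms(1,2) by (simp add: unital_hom.eval_pCons algebra_simps)
  show ?case
    unfolding * using assms(3,4) pCons.IH by (intro dvd_add dvd_mult dvd_mult2)
qed simp

lemma dvd_eval2_diff:
  assumes "unital_hom h" "d dvd u - u'" "d dvd v - v'"
  shows "d dvd eval2 h u v G - eval2 h u' v' G"
  unfolding eval2_def using assms by (intro dvd_eval_diff unital_hom.eval) auto

section \<open>Roots and translation invariance of univariate polynomials\<close>

lemma prod_linear_dvd: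
  fixes p :: "'a::idom poly"
  assumes "finite A" "\<And>a. a \<in> A \<Longrightarrow> poly p a = 0"
  shows "(\<Prod>a\<in>A. [:- a, 1:]) dvd p"
  using assms
proof (induction A arbitrary: p rule: finite_induct)
  case (insert a A)
  obtain r where r: "p = [:- a, 1:] * r"
    using insert.prems[of a] by (auto simp: poly_eq_0_iff_dvd)
  have "poly r b = 0" if "b \<in> A" for b
    using insert.prems[of b] insert.hyps that by (auto simp: r)
  then have "(\<Prod>a\<in>A. [:- a, 1:]) dvd r"
    by (rule insert.IH)
  then show ?case
    using insert.hyps by (simp add: r mult_dvd_mono del: mult_pCons_left)
qed simp

lemma degree_prod_linear: "degree (\<Prod>a\<in>A. [:- (a::'a::idom), 1:]) = card A"
  by (simp add: degree_prod_eq_sum_degree)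

text \<open>All roots are simple, so splitting one off leaves a polynomial of the same kind.\<close>

lemma card_roots_separable:
  fixes p :: "'k::field poly"
  assumes closed: "\<And>f::'k poly. degree f > 0 \<Longrightarrow> \<exists>x. poly f x = 0"
    and "p \<noteq> 0" "\<And>x. poly p x = 0 \<Longrightarrow> poly (pderiv p) x \<noteq> 0"
  shows "card {x. poly p x = 0} = degree p"
  using assms(2,3)
proof (induction "degree p" arbitrary: p)
  case 0
  then have "{x. poly p x = 0} = {}"
    by (auto elim!: degree_eq_zeroE)
  then show ?case
    using 0 by simp
next
  case (Suc n)
  obtain a where a: "poly p a = 0"
    using closed[of p] Suc.hyps(2) by auto
  then obtain r where r: "p = [:- a, 1:] * r"
    by (auto simp: poly_eq_0_iff_dvd)
  have "r \<noteq> 0"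
    using r Suc.prems(1) by auto
  have pd: "poly (pderiv p) x = poly r x + (x - a) * poly (pderiv r) x" for x
    unfolding r pderiv_mult by (simp add: pderiv_pCons algebra_simps)
  have ra: "poly r a \<noteq> 0"
    using Suc.prems(2)[OF a] pd[of a] by simp
  have deg: "degree p = Suc (degree r)"
    using \<open>r \<noteq> 0\<close> by (simp add: r degree_mult_eq del: mult_pCons_left)
  have "poly (pderiv r) x \<noteq> 0" if "poly r x = 0" for x
    using Suc.prems(2)[of x] that ra pd[of x] by (auto simp: r)
  then have "card {x. poly r x = 0} = degree r"
    using Suc.hyps deg \<open>r \<noteq> 0\<close> by auto
  moreover have "{x. poly p x = 0} = insert a {x. poly r x = 0}"
    by (auto simp: r)
  ultimately show ?case
    using ra deg poly_roots_finite[OF \<open>r \<noteq> 0\<close>] by simp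
qed

text \<open>If \<open>f\<close> is invariant then \<open>f - f(0)\<close> vanishes on \<open>A\<close>, so it is a multiple of
  \<open>\<Prod>a\<in>A. T - a\<close> whose cofactor is again invariant.\<close>
lemma translation_invariant_pcompose:
  fixes f :: "'a::idom poly" and A :: "'a set"
  defines "N \<equiv> \<Prod>a\<in>A. [:- a, 1:]"
  assumes "finite A" "0 \<in> A"
    and N: "\<And>a. a \<in> A \<Longrightarrow> pcompose N [:a, 1:] = N"
    and f: "\<And>a. a \<in> A \<Longrightarrow> pcompose f [:a, 1:] = f"
  shows "\<exists>G. f = pcompose G N"
  using f
proof (induction "degree f" arbitrary: f rule: less_induct)
  case less
  have "N \<noteq> 0"
    using assms(2) by (auto simp: N_def)
  have degN: "degree N > 0"
    unfolding N_def degree_prod_linear using assms by (auto simp: card_gt_0_iff)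
  have "poly f a = poly f 0" if "a \<in> A" for a
    using arg_cong[OF less.prems[OF that], of "\<lambda>f. poly f 0"] by (simp add: poly_pcompose)
  then have "N dvd f - [:poly f 0:]"
    unfolding N_def using assms(2) by (intro prod_linear_dvd) auto
  then obtain r where "f - [:poly f 0:] = N * r" ..
  then have r: "f = [:poly f 0:] + N * r"
    by (simp add: algebra_simps)
  show ?case
  proof (cases "r = 0")
    case True
    then have "f = pcompose [:poly f 0:] N"
      using r by (metis add.right_neutral mult_zero_right pcompose_const)
    then show ?thesis ..
  next
    case False
    have "degree f = degree (N * r)"
      by (subst r, rule degree_add_eq_right)
         (use \<open>N \<noteq> 0\<close> False degN in \<open>auto simp: degree_mult_eq\<close>)
    then have deg: "degree r < degree f"
      using \<open>N \<noteq> 0\<close> False degN by (auto simp: degree_mult_eq)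
    have "pcompose r [:a, 1:] = r" if "a \<in> A" for a
    proof -
      have "[:poly f 0:] + N * pcompose r [:a, 1:] = [:poly f 0:] + N * r"
        using less.prems[OF that] unfolding r[symmetric]
        by (subst (asm) (1) r) (simp add: pcompose_add pcompose_mult N[OF that])
      then show ?thesis
        using \<open>N \<noteq> 0\<close> by simp
    qed
    from less.hyps[OF deg this] obtain G where "r = pcompose G N" by blast
    then have "f = pcompose (pCons (poly f 0) G) N"
      using r by (simp add: pcompose_pCons)
    then show ?thesis ..
  qed
qed

lemma pcompose_inject:
  fixes N :: "'a::idom poly"
  assumes "pcompose G N = pcompose H N" "degree N > 0"
  shows "G = H"
  using assms pcompose_eq_0[of "G - H" N] by (simp add: pcompose_diff)

section \<open>Dehomogenization\<close>

lemma frobenius_add: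
  fixes x y :: "'a::comm_ring_1"
  assumes "prime CHAR('a)" "q = CHAR('a) ^ n"
  shows "(x + y) ^ q = x ^ q + y ^ q"
  using assms freshmans_dream' by blast

lemma frobenius_diff:
  fixes x y :: "'a::comm_ring_1"
  assumes "prime CHAR('a)" "q = CHAR('a) ^ n"
  shows "(x - y) ^ q = x ^ q - y ^ q"
  using frobenius_add[OF assms, of "x - y" y] by simp

text \<open>In a form of degree \<open>d\<close> the exponents of \<open>X\<close> and
  \<open>Y\<close> determine that of \<open>Z\<close>, so setting \<open>Z = 1\<close> merges no
  monomials.\<close>

lemma coeff_dehomogenize:
  assumes "plane_curve d F"
  shows "coeff (coeff (poly F 1) j) i
    = (if i + j \<le> d then coeff (coeff (coeff F (d - i - j)) j) i else 0)"
proof -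
  have hom: "i + j + k = d" if "coeff (coeff (coeff F k) j) i \<noteq> 0" for k
    using assms that by (auto simp: plane_curve_def)
  have "coeff (coeff (poly F 1) j) i = (\<Sum>k\<le>degree F. coeff (coeff (coeff F k) j) i)"
    by (simp add: poly_altdef coeff_sum)
  also have "\<dots> = (\<Sum>k\<in>{d - i - j} \<inter> {..degree F}. coeff (coeff (coeff F k) j) i)"
    by (rule sum.mono_neutral_right) (use hom in force)+
  also have "\<dots> = coeff (coeff (coeff F (d - i - j)) j) i"
    by (cases "d - i - j \<le> degree F") (auto simp: coeff_eq_0)
  also have "\<dots> = (if i + j \<le> d then coeff (coeff (coeff F (d - i - j)) j) i else 0)"
    using hom[of "d - i - j"] by force
  finally show ?thesis .
qed

lemma degree_dehomogenize_le:
  assumes "plane_curve d F"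
  shows "degree (poly F 1) \<le> d"
  by (rule degree_le) (auto simp: poly_eq_iff coeff_dehomogenize[OF assms])

lemma dehomogenize_nonzero:
  assumes "plane_curve d F"
  shows "poly F 1 \<noteq> 0"
proof -
  obtain i j k where *: "coeff (coeff (coeff F k) j) i \<noteq> 0"
    using assms by (auto simp: plane_curve_def poly_eq_iff)
  then have "i + j + k = d"
    using assms by (auto simp: plane_curve_def)
  then have "coeff (coeff (poly F 1) j) i \<noteq> 0"
    using * by (auto simp: coeff_dehomogenize[OF assms] split: if_splits)
  then show ?thesis by auto
qed

lemma dvd_dehomogenize_Y:
  fixes F :: "'k::idom poly3"
  assumes "plane_curve d F" "[:0, 1:] dvd poly F 1"
  shows "varY dvd F"
proof -
  have "coeff (coeff (coeff F k) 0) i = 0" for i k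
  proof (rule ccontr)
    assume *: "coeff (coeff (coeff F k) 0) i \<noteq> 0"
    then have "i + k = d"
      using assms(1) by (force simp: plane_curve_def)
    moreover have "coeff (poly F 1) 0 = 0"
      using assms(2) poly_eq_0_iff_dvd[of "poly F 1" 0] by (simp add: poly_0_coeff_0)
    ultimately show False
      using coeff_dehomogenize[OF assms(1), of 0 i] * by auto
  qed
  then have "[:0, 1:] dvd coeff F k" for k
    using poly_eq_0_iff_dvd[of "coeff F k" 0] by (simp add: poly_0_coeff_0 poly_eq_iff)
  then show ?thesis
    unfolding varY_def const_poly_dvd_iff by blast
qed

lemma not_unit_varY: "\<not> varY dvd (1 :: 'k::field poly3)"
  by (auto simp: varY_def is_unit_poly_iff)

lemma not_unit_varZ: "\<not> varZ dvd (1 :: 'k::field poly3)"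
  by (simp add: varZ_def is_unit_poly_iff)

lemma irreducible_varY_dvd:
  fixes F :: "'k::field poly3"
  assumes "plane_curve d F" "irreducible F" "varY dvd F"
  shows "d = 1"
proof -
  obtain G where G: "F = varY * G"
    using assms(3) by blast
  then have "G dvd 1"
    using irreducibleD[OF assms(2) G] not_unit_varY by blast
  then obtain c where "c dvd 1" "G = const3 c"
    by (auto simp: is_unit_poly_iff const3_def)
  then have "c \<noteq> 0" by auto
  then have "coeff (coeff (coeff F 0) 1) 0 \<noteq> 0"
    by (simp add: G \<open>G = const3 c\<close> varY_def const3_def)
  then show ?thesis
    using assms(1) by (force simp: plane_curve_def)
qed

text \<open>A constant affine equation \<open>c\<close> comes from \<open>F = c Z^d\<close>, which
  factors when \<open>d > 1\<close>.\<close>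

lemma irreducible_dehomogenize_const:
  fixes F :: "'k::field poly3"
  assumes F: "plane_curve d F" "irreducible F" and "poly F 1 = [:[:c:]:]"
  shows "d = 1"
proof (rule ccontr)
  assume "d \<noteq> 1"
  then have d: "d = Suc (d - 1)" "d - 1 > 0"
    using F by (auto simp: plane_curve_def)
  have "coeff (coeff (coeff F k) j) i = coeff (coeff (coeff (monom [:[:c:]:] d) k) j) i" for i j k
  proof (cases "i + j + k = d")
    case True
    then have "coeff (coeff (coeff F k) j) i = coeff (coeff (poly F 1) j) i"
      by (auto simp: coeff_dehomogenize[OF F(1)])
    then show ?thesis
      using True assms(3) by (auto simp: coeff_pCons split: nat.splits)
  next
    case False
    then have "coeff (coeff (coeff F k) j) i = 0"
      using F(1) by (auto simp: plane_curve_def)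
    then show ?thesis
      using False by (auto simp: coeff_pCons split: nat.splits)
  qed
  then have eq: "F = monom [:[:c:]:] d"
    by (simp add: poly_eq_iff)
  then have "F = varZ * monom [:[:c:]:] (d - 1)"
    by (subst (asm) d(1)) (simp add: varZ_def monom_Suc)
  moreover have "\<not> monom [:[:c:]:] (d - 1) dvd 1"
  proof -
    have "c \<noteq> 0"
      using eq F by (auto simp: plane_curve_def)
    then have "degree (monom [:[:c:]:] (d - 1)) > 0"
      using d by (simp add: degree_monom_eq)
    then show ?thesis
      by (auto simp: is_unit_poly_iff)
  qed
  ultimately show False
    using irreducibleD[OF F(2)] not_unit_varZ by blast
qed

lemma less_3_cases: "i < (3::nat) \<longleftrightarrow> i = 0 \<or> i = 1 \<or> i = 2"
  by auto

text \<open>A matrix with last row \<open>0, 0, 1\<close> keeps \<open>Z = 1\<close>, so it acts by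
  an affine map; \<open>[:[:e, a:], [:b:]:]\<close> is \<open>e + a x + b y\<close>.\<close>

lemma AGL_invariant_affine:
  fixes F :: "'k::field poly3"
  assumes "AGL_invariant q F" "q > 0"
    and "in_Fq q a" "in_Fq q b" "in_Fq q e" "in_Fq q a'" "in_Fq q b'" "in_Fq q e'"
    and "a * b' \<noteq> b * a'"
  shows "\<exists>c. c \<noteq> 0 \<and> eval2 (\<lambda>c. [:[:c:]:]) [:[:e, a:], [:b:]:] [:[:e', a':], [:b':]:] (poly F 1)
    = smult [:c:] (poly F 1)"
proof -
  define M :: "nat \<Rightarrow> nat \<Rightarrow> 'k"
    where "M = (\<lambda>i j. [[a, b, e], [a', b', e'], [0, 0, 1]] ! i ! j)"
  have "AGL_mat q M"
    using assms by (auto simp: AGL_mat_def M_def less_3_cases det3_def in_Fq_def)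
  then obtain c where c: "c \<noteq> 0" "lin_subst M F = const3 c * F"
    using assms(1) by (auto simp: AGL_invariant_def)
  have "poly (lin_subst M F) 1
      = eval2 (\<lambda>c. [:[:c:]:]) [:[:e, a:], [:b:]:] [:[:e', a':], [:b':]:] (poly F 1)"
    unfolding lin_subst_def
    by (subst poly_subst3_1) (simp_all add: M_def const3_def varX_def varY_def varZ_def one_pCons)
  moreover have "poly (lin_subst M F) 1 = smult [:c:] (poly F 1)"
    by (simp add: c const3_def)
  ultimately show ?thesis
    using c(1) by metis
qed

section \<open>The field \<open>K\<close> and its subfield of order \<open>q\<close>\<close>

locale closed_char =
  fixes p q n :: nat and K :: "'k::field itself"
  assumes prime: "prime p" and n: "n > 0" and q: "q = p ^ n"
    and char: "of_nat p = (0 :: 'k)"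
    and closed: "\<And>f::'k poly. degree f > 0 \<Longrightarrow> \<exists>x. poly f x = 0"
begin

lemma CHAR: "CHAR('k) = p"
proof -
  have "CHAR('k) dvd p"
    using char by (simp add: of_nat_eq_0_iff_char_dvd)
  then show ?thesis
    using prime by (metis CHAR_not_1' One_nat_def prime_nat_iff)
qed

lemma q_ge_2: "q \<ge> 2"
  using prime n q by (metis prime_ge_2_nat one_le_power self_le_power order_trans
      prime_ge_1_nat)

lemma of_nat_q: "of_nat q = (0 :: 'k)"
  using n char by (simp add: q)

abbreviation Fq :: "'k set" where "Fq \<equiv> {x. x ^ q = x}"

lemma frobK: "((x::'k) + y) ^ q = x ^ q + y ^ q" "((x::'k) - y) ^ q = x ^ q - y ^ q"
  by (rule frobenius_add frobenius_diff; simp add: CHAR prime q)+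

lemma frobKx: "((x::'k poly) + y) ^ q = x ^ q + y ^ q" "((x::'k poly) - y) ^ q = x ^ q - y ^ q"
  by (rule frobenius_add frobenius_diff; simp add: CHAR prime q)+

lemma frobKxy: "((x::'k poly poly) + y) ^ q = x ^ q + y ^ q"
    "((x::'k poly poly) - y) ^ q = x ^ q - y ^ q"
  by (rule frobenius_add frobenius_diff; simp add: CHAR prime q)+

lemma frobKxyz: "((x::'k poly3) + y) ^ q = x ^ q + y ^ q" "((x::'k poly3) - y) ^ q = x ^ q - y ^ q"
  by (rule frobenius_add frobenius_diff; simp add: CHAR prime q)+

lemma degree_artin_schreier: "degree (monom 1 q - [:0, 1::'a::comm_ring_1:]) = q"
  using q_ge_2 by (subst diff_conv_add_uminus, subst degree_add_eq_left) (simp_all add: degree_monom_eq)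

lemma pderiv_artin_schreier: "pderiv (monom 1 q - [:0, 1::'k:]) = - 1"
  by (simp add: pderiv_diff pderiv_monom of_nat_q pderiv_pCons one_pCons)

lemma card_Fq: "card Fq = q"
proof -
  let ?w = "monom 1 q - [:0, 1::'k:]"
  have "?w \<noteq> 0"
    using degree_artin_schreier[where 'a = 'k] q_ge_2 by (metis degree_0 not_numeral_le_zero)
  then have "card {x. poly ?w x = 0} = degree ?w"
    by (intro card_roots_separable[OF closed]) (simp_all add: pderiv_artin_schreier)
  then show ?thesis
    by (simp add: degree_artin_schreier poly_monom)
qed

text \<open>The derivative of \<open>w^(q-1) + 1\<close> with \<open>w = T^q - T\<close> is
  \<open>w^(q-2)\<close>, as both \<open>q - 1\<close> and the derivative of \<open>w\<close> are
  \<open>-1\<close> in \<open>K\<close>; at a root \<open>w\<close> is nonzero.\<close>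

lemma card_frobenius_diff_roots: "card {b::'k. (b ^ q - b) ^ (q - 1) = - 1} = q * (q - 1)"
proof -
  let ?w = "monom 1 q - [:0, 1::'k:]"
  let ?J = "?w ^ (q - 1) + 1"
  have "?w \<noteq> 0"
    using degree_artin_schreier[where 'a = 'k] q_ge_2 by (metis degree_0 not_numeral_le_zero)
  then have deg: "degree ?J = q * (q - 1)"
    using q_ge_2
    by (subst degree_add_eq_left) (simp_all add: degree_power_eq degree_artin_schreier)
  have "poly (pderiv ?J) x \<noteq> 0" if "poly ?J x = 0" for x
  proof -
    have "(x ^ q - x) ^ (q - 1) = - 1"
      using that by (simp add: poly_monom add_eq_0_iff2)
    then have "x ^ q - x \<noteq> 0"
      using q_ge_2 by (auto simp: power_0_left)
    moreover have "of_nat (q - 1) = (- 1 :: 'k)"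
      using of_nat_q q_ge_2 by (simp add: of_nat_diff)
    ultimately show ?thesis
      by (simp add: pderiv_add pderiv_power pderiv_artin_schreier poly_monom)
  qed
  then have "card {x. poly ?J x = 0} = degree ?J"
    using deg q_ge_2 by (intro card_roots_separable[OF closed]) auto
  then show ?thesis
    using deg by (simp add: poly_monom add_eq_0_iff2)
qed

lemma finite_Fq: "finite Fq"
  using card_Fq q_ge_2 by (metis card.infinite not_numeral_le_zero)

lemma Fq_closed:
  assumes "a \<in> Fq" "b \<in> Fq"
  shows "a + b \<in> Fq" "a - b \<in> Fq" "a * b \<in> Fq" "a / b \<in> Fq" "0 \<in> Fq" "1 \<in> Fq"
  using assms q_ge_2 by (auto simp: frobK power_mult_distrib power_divide)

end

section \<open>The lower bound\<close>

text \<open>Setting \<open>x = 0\<close> in \<open>g(x + y) = h(x)\<close> leaves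
  \<open>g(y) = h(0)\<close>, a constant.\<close>

lemma eval2_const_shear:
  fixes g :: "'k::comm_ring_1 poly"
  assumes "eval2 (\<lambda>c. [:[:c:]:]) [:[:0, 1:], 1:] v [:g:] = [:h:]"
  shows "g = [:poly h 0:]"
proof -
  define ev where "ev = eval2 (\<lambda>c::'k. [:c:]) 0 [:0, 1:]"
  have ev: "unital_hom ev"
    unfolding ev_def by (intro unital_hom_eval2 unital_hom_const)
  have ev_gens: "ev [:[:c:]:] = [:c:]" "ev [:[:0, 1:]:] = 0" "ev [:0, 1:] = [:0, 1:]" for c
    by (simp_all add: ev_def unital_hom_const)
  have "[:[:0, 1:], 1:] = [:[:0, 1:]:] + [:0, 1::'k poly:]"
    by simp
  then have ev_shear: "ev [:[:0, 1:], 1:] = [:0, 1:]"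
    using unital_hom.add[OF ev] ev_gens by (metis add.left_neutral)
  have "g = ev (eval2 (\<lambda>c. [:[:c:]:]) [:[:0, 1:], 1:] v [:g:])"
    by (rule unital_hom_poly_eqI[of "\<lambda>g. g"])
       (auto intro!: unital_hom_comp[OF ev] unital_hom_comp[OF unital_hom_eval2 unital_hom_const]
          unital_hom_const2 simp: unital_hom_const2 ev_gens ev_shear, unfold_locales, auto)
  also have "\<dots> = ev [:h:]"
    by (simp add: assms)
  also have "\<dots> = [:poly h 0:]"
    by (rule unital_hom_poly_eqI[of "\<lambda>h. ev [:h:]" "\<lambda>h. [:poly h 0:]"])
       (auto intro!: unital_hom_comp[OF ev] unital_hom_comp[OF unital_hom_const] unital_hom_poly
          unital_hom_const simp: ev_gens)
  finally show ?thesis .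
qed

context closed_char
begin

section \<open>Affine forms over \<open>F_q\<close> and their norm form\<close>

definition affine_forms :: "'k poly set" where
  "affine_forms = (\<lambda>(a, b). [:a, b:]) ` (Fq \<times> Fq)"

lemma card_affine_forms: "card affine_forms = q ^ 2"
proof -
  have "inj_on (\<lambda>(a, b). [:a, b:]) (Fq \<times> Fq)"
    by (auto simp: inj_on_def)
  then show ?thesis
    by (simp add: affine_forms_def card_image card_cartesian_product card_Fq power2_eq_square)
qed

lemma finite_affine_forms: "finite affine_forms"
  by (simp add: affine_forms_def finite_Fq)

lemma affine_forms_closed:
  assumes "f \<in> affine_forms"
  shows "g \<in> affine_forms \<Longrightarrow> f + g \<in> affine_forms" "g \<in> affine_forms \<Longrightarrow> f - g \<in> affine_forms"
    "c \<in> Fq \<Longrightarrow> smult c f \<in> affine_forms"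
  using assms Fq_closed by (auto simp: affine_forms_def image_iff)

lemma zero_affine_forms: "0 \<in> affine_forms"
  using Fq_closed(5)[of 0 0] q_ge_2 by (force simp: affine_forms_def image_iff)

text \<open>Up to a factor in \<open>K[x]\<close> this is the Moore determinant of
  \<open>1, x, y\<close>. Its roots in \<open>y\<close> form a vector space over
  \<open>F_q\<close>.\<close>

definition norm_form :: "'k poly poly" where
  "norm_form = (\<Prod>a\<in>affine_forms. [:- a, 1:])"

lemma degree_norm_form: "degree norm_form = q ^ 2"
  by (simp add: norm_form_def degree_prod_linear card_affine_forms)

lemma norm_form_translate:
  assumes a: "a \<in> affine_forms"
  shows "pcompose norm_form [:a, 1:] = norm_form"
proof -
  have "pcompose norm_form [:a, 1:] = (\<Prod>b\<in>affine_forms. [:- (b - a), 1:])"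
    by (simp add: norm_form_def pcompose_prod pcompose_pCons)
  also have "\<dots> = norm_form"
    unfolding norm_form_def
    by (rule prod.reindex_bij_witness[of _ "\<lambda>b. b + a" "\<lambda>b. b - a"])
       (use a affine_forms_closed in auto)
  finally show ?thesis .
qed

text \<open>Each factor \<open>c y - l\<close> is \<open>c (y - l/c)\<close>, the forms
  \<open>l/c\<close> are again all affine forms, and \<open>c^(q^2) = c\<close>.\<close>

lemma norm_form_scale:
  assumes c: "c \<in> Fq" "c \<noteq> 0"
  shows "pcompose norm_form [:0, [:c:]:] = smult [:c:] norm_form"
proof -
  have "pcompose norm_form [:0, [:c:]:] = (\<Prod>b\<in>affine_forms. smult [:c:] [:- smult (1 / c) b, 1:])"
    using c by (simp add: norm_form_def pcompose_prod pcompose_pCons)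
  also have "\<dots> = smult ([:c:] ^ q ^ 2) (\<Prod>b\<in>affine_forms. [:- smult (1 / c) b, 1:])"
    by (simp only: prod_smult prod_constant card_affine_forms)
  also have "(\<Prod>b\<in>affine_forms. [:- smult (1 / c) b, 1:]) = norm_form"
    unfolding norm_form_def
    by (rule prod.reindex_bij_witness[of _ "\<lambda>b. smult c b" "\<lambda>b. smult (1 / c) b"])
       (use c affine_forms_closed(3)[of _ "1 / c"] affine_forms_closed(3)[of _ c]
          Fq_closed(4)[of 1 c] in auto)
  also have "c ^ q ^ 2 = c"
    using c by (simp add: power2_eq_square power_mult)
  then have "[:c:] ^ q ^ 2 = [:c:]"
    by (simp add: poly_const_pow)
  finally show ?thesis .
qed

text \<open>Comparing coefficients gives \<open>c^k = c^l\<close> for all \<open>q - 1\<close>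
  nonzero \<open>c\<close> in \<open>F_q\<close>, so \<open>T^(l-k) - 1\<close> has more roots than
  its degree allows.\<close>

lemma monomial_of_torus_eigenvector:
  assumes "degree G < q - 1"
    and eig: "\<And>c. c \<in> Fq \<Longrightarrow> c \<noteq> 0 \<Longrightarrow> \<exists>\<chi>. pcompose G [:0, [:c:]:] = smult [:\<chi>:] G"
    and kl: "coeff G k \<noteq> (0::'k poly)" "coeff G l \<noteq> 0" "k < l"
  shows False
proof -
  have "c ^ (l - k) = 1" if c: "c \<in> Fq" "c \<noteq> 0" for c
  proof -
    obtain \<chi> where \<chi>: "pcompose G [:0, [:c:]:] = smult [:\<chi>:] G"
      using eig[OF c] by blast
    have "[:c:] ^ i = [:\<chi>:]" if "coeff G i \<noteq> 0" for i
      using arg_cong[OF \<chi>, of "\<lambda>G. coeff G i"] that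
      by (metis coeff_pcompose_linear coeff_smult mult_right_cancel)
    then have "[:c:] ^ k = [:c:] ^ l"
      using kl by metis
    then have "c ^ k = c ^ l"
      by (simp add: poly_const_pow)
    also have "c ^ l = c ^ k * c ^ (l - k)"
      using kl(3) by (simp flip: power_add)
    finally show ?thesis
      using c by simp
  qed
  then have sub: "Fq - {0} \<subseteq> {x. poly (monom 1 (l - k) - 1) x = 0}"
    by (auto simp: poly_monom)
  have "degree (monom (1::'k) (l - k) - 1) = l - k"
    using kl(3) by (subst diff_conv_add_uminus, subst degree_add_eq_left)
      (simp_all add: degree_monom_eq)
  moreover from this have nz: "monom (1::'k) (l - k) - 1 \<noteq> 0"
    using kl(3) by (metis degree_0 zero_less_diff less_irrefl)
  ultimately have "card {x. poly (monom (1::'k) (l - k) - 1) x = 0} \<le> l - k"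
    using card_poly_roots_bound by metis
  moreover have "card (Fq - {0}) = q - 1"
    using Fq_closed(5)[of 0 0] finite_Fq card_Fq q_ge_2 by (simp add: card_Diff_singleton)
  moreover have "l \<le> degree G"
    using kl(2) by (rule le_degree)
  ultimately show False
    using card_mono[OF poly_roots_finite[OF nz] sub] assms(1) by linarith
qed

lemma AGL_invariant_degree_ge:
  fixes F :: "'k poly3"
  assumes F: "plane_curve d F" "irreducible F" "AGL_invariant q F" "d \<noteq> 1"
  shows "q ^ 3 - q ^ 2 \<le> d"
proof (rule ccontr)
  assume small: "\<not> q ^ 3 - q ^ 2 \<le> d"
  define f where "f = poly F 1"
  have "f \<noteq> 0" "degree f \<le> d"
    using dehomogenize_nonzero[OF F(1)] degree_dehomogenize_le[OF F(1)] by (simp_all add: f_def)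
  have Fq01: "in_Fq q (0::'k)" "in_Fq q (1::'k)" "q > 0"
    using q_ge_2 by (auto simp: in_Fq_def)
  note affine = AGL_invariant_affine[OF F(3) Fq01(3), folded f_def]
  have translate: "pcompose f [:a, 1:] = f" if a_in: "a \<in> affine_forms" for a
  proof -
    obtain a0 a1 where a: "a = [:a0, a1:]" "in_Fq q a0" "in_Fq q a1"
      using a_in unfolding affine_forms_def in_Fq_def by auto
    \<comment> \<open>The entries chosen below give the shear
      \<open>y \<mapsto> y + a0 + a1 x\<close>.\<close>
    obtain c where "c \<noteq> 0"
      and c: "eval2 (\<lambda>c. [:[:c:]:]) [:[:0, 1:], [:0:]:] [:a, [:1:]:] f = smult [:c:] f"
      using affine[of 1 0 0 a1 1 a0] a Fq01 by auto
    then have c: "pcompose f [:a, 1:] = smult [:c:] f"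
      using eval2_pcompose[of "[:a, 1:]" f] by (simp flip: one_pCons)
    \<comment> \<open>The shear keeps the leading coefficient in \<open>y\<close>, so the eigenvalue
      \<open>c\<close> is 1.\<close>
    have "lead_coeff (pcompose f [:a, 1:]) = lead_coeff f"
      by (subst lead_coeff_comp) simp_all
    then have "[:c:] * lead_coeff f = 1 * lead_coeff f"
      unfolding c by (metis lead_coeff_smult mult_1)
    then have "[:c:] = 1"
      using \<open>f \<noteq> 0\<close> by (metis leading_coeff_0_iff mult_right_cancel)
    then show ?thesis
      using c by simp
  qed
  obtain G where G: "f = pcompose G norm_form"
    using translation_invariant_pcompose[OF finite_affine_forms zero_affine_forms, of f]
      norm_form_translate translate unfolding norm_form_def by blast
  have degN: "degree norm_form > 0"
    using q_ge_2 by (simp add: degree_norm_form)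
  have "q ^ 2 * degree G = degree f"
    by (simp add: G degree_pcompose degree_norm_form)
  also have "\<dots> < q ^ 2 * (q - 1)"
    using small \<open>degree f \<le> d\<close> by (simp add: power2_eq_square power3_eq_cube algebra_simps)
  finally have degG: "degree G < q - 1"
    by simp
  \<comment> \<open>All \<open>\<delta> \<in> F\<^sub>q\<^sup>*\<close> scale \<open>norm_form\<close> by \<open>\<delta>\<close>, and \<open>deg G < q - 1\<close> makes the characters
    of its monomials distinct; hence \<open>G\<close> is a single monomial.\<close>
  have eig: "\<exists>\<chi>. pcompose G [:0, [:c:]:] = smult [:\<chi>:] G" if c: "c \<in> Fq" "c \<noteq> 0" for c
  proof -
    obtain \<chi> where
      "eval2 (\<lambda>c. [:[:c:]:]) [:[:0, 1:], [:0:]:] [:[:0, 0:], [:c:]:] f = smult [:\<chi>:] f"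
      using affine[of 1 0 0 0 c 0] c Fq01 by (auto simp: in_Fq_def)
    then have \<chi>: "pcompose f [:0, [:c:]:] = smult [:\<chi>:] f"
      using eval2_pcompose[of "[:0, [:c:]:]" f] by simp
    \<comment> \<open>Scaling \<open>y\<close> by \<open>c\<close> scales \<open>norm_form\<close>
      by \<open>c\<close>, so \<open>G(c N)\<close> is \<open>f(x, c y)\<close>; the composition
      with \<open>norm_form\<close> is cancelled at the end.\<close>
    have "pcompose (pcompose G [:0, [:c:]:]) norm_form = pcompose G (smult [:c:] norm_form)"
      by (simp add: pcompose_assoc[symmetric] pcompose_pCons)
    also have "\<dots> = pcompose f [:0, [:c:]:]"
      by (simp add: G norm_form_scale[OF c] flip: pcompose_assoc)
    also have "\<dots> = pcompose (smult [:\<chi>:] G) norm_form"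
      using \<chi> by (simp add: pcompose_smult flip: G)
    finally show ?thesis
      using pcompose_inject degN by blast
  qed
  have G_coeff: "coeff G k = 0" if "k \<noteq> degree G" for k
  proof (rule ccontr)
    assume "coeff G k \<noteq> 0"
    moreover from this that have "k < degree G"
      using le_degree le_neq_implies_less by blast
    moreover have "coeff G (degree G) \<noteq> 0"
      using \<open>f \<noteq> 0\<close> by (auto simp: G)
    ultimately show False
      using monomial_of_torus_eigenvector[OF degG eig] by blast
  qed
  have "d = 1"
  proof (cases "degree G = 0")
    case True
    then obtain g where "f = [:g:]"
      using G by (auto elim!: degree_eq_zeroE)
    moreover obtain \<chi> where
      "eval2 (\<lambda>c. [:[:c:]:]) [:[:0, 1:], [:1:]:] [:[:0, 0:], [:1:]:] f = smult [:\<chi>:] f"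
      using affine[of 1 1 0 0 1 0] Fq01 by auto
    ultimately have "eval2 (\<lambda>c. [:[:c:]:]) [:[:0, 1:], 1:] [:0, 1:] [:g:] = [:smult \<chi> g:]"
      by (simp flip: one_pCons)
    then have "g = [:poly (smult \<chi> g) 0:]"
      by (rule eval2_const_shear)
    then show ?thesis
      using irreducible_dehomogenize_const[OF F(1,2)] \<open>f = [:g:]\<close> f_def by metis
  next
    case False
    have "poly norm_form 0 = 0"
      using zero_affine_forms finite_affine_forms
      by (auto simp: norm_form_def poly_prod prod_zero_iff)
    then have "poly f 0 = 0"
      using False G_coeff[of 0] by (simp add: G poly_pcompose poly_0_coeff_0)
    then have "[:0, 1:] dvd f"
      using poly_eq_0_iff_dvd[of f 0] by simp
    then show ?thesis
      using irreducible_varY_dvd[OF F(1,2) dvd_dehomogenize_Y[OF F(1)]] f_def by simp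
  qed
  then show False
    using F(4) by simp
qed

end

section \<open>Homogeneous forms and the Dickson invariant\<close>

text \<open>Unlike \<open>plane_curve\<close> this admits 0 and degree 0, so sums and differences in
  one degree stay inside.\<close>

definition homog :: "nat \<Rightarrow> 'k::comm_ring_1 poly3 \<Rightarrow> bool" where
  "homog d F \<longleftrightarrow> (\<forall>i j k. coeff (coeff (coeff F k) j) i \<noteq> 0 \<longrightarrow> i + j + k = d)"

lemma homog_add: "homog d F \<Longrightarrow> homog d G \<Longrightarrow> homog d (F + G)"
  unfolding homog_def coeff_add by (metis add.right_neutral add.left_neutral)

lemma homog_diff: "homog d F \<Longrightarrow> homog d G \<Longrightarrow> homog d (F - G)"
  unfolding homog_def coeff_diff by (metis diff_zero add.left_neutral diff_self eq_iff_diff_eq_0)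

lemma homog_mult:
  assumes "homog d F" "homog e G"
  shows "homog (d + e) (F * G)"
  unfolding homog_def
proof (intro allI impI)
  fix i j k
  assume "coeff (coeff (coeff (F * G) k) j) i \<noteq> 0"
  then have "(\<Sum>k'\<le>k. \<Sum>j'\<le>j. \<Sum>i'\<le>i. coeff (coeff (coeff F k') j') i' *
      coeff (coeff (coeff G (k - k')) (j - j')) (i - i')) \<noteq> 0"
    by (simp add: coeff_mult coeff_sum)
  then obtain k' j' i' where le: "k' \<le> k" "j' \<le> j" "i' \<le> i"
    and nz: "coeff (coeff (coeff F k') j') i' \<noteq> 0"
      "coeff (coeff (coeff G (k - k')) (j - j')) (i - i') \<noteq> 0"
    by (metis (no_types, lifting) sum.neutral atMost_iff mult_zero_left mult_zero_right)
  have "i' + j' + k' = d" "(i - i') + (j - j') + (k - k') = e"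
    using assms nz unfolding homog_def by blast+
  then show "i + j + k = d + e"
    using le by linarith
qed

lemma homog_1: "homog 0 1"
  by (auto simp: homog_def coeff_1 split: if_splits)

lemma homog_power: "homog d F \<Longrightarrow> homog (d * n) (F ^ n)"
  by (induction n) (auto simp: homog_1 intro: homog_mult)

lemma homog_vars: "homog 1 varX" "homog 1 varY" "homog 1 varZ"
  by (auto simp: homog_def varX_def varY_def varZ_def coeff_pCons split: nat.splits if_splits)

lemma poly3_induct [case_names const add X Y Z]:
  fixes F :: "'k::comm_ring_1 poly3"
  assumes const: "\<And>c. P (const3 c)"
    and add: "\<And>F G. P F \<Longrightarrow> P G \<Longrightarrow> P (F + G)"
    and X: "\<And>F. P F \<Longrightarrow> P (varX * F)"
    and Y: "\<And>F. P F \<Longrightarrow> P (varY * F)"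
    and Z: "\<And>F. P F \<Longrightarrow> P (varZ * F)"
  shows "P F"
proof -
  have zero: "P 0"
    using const[of 0] by (simp add: const3_def)
  have 1: "P [:[:g:]:]" for g
  proof (induction g)
    case (pCons c g)
    have "[:[:pCons c g:]:] = const3 c + varX * [:[:g:]:]"
      by (simp add: const3_def varX_def)
    then show ?case
      using add[OF const X[OF pCons.IH]] by metis
  qed (simp add: zero)
  have 2: "P [:g:]" for g
  proof (induction g)
    case (pCons c g)
    have "[:pCons c g:] = [:[:c:]:] + varY * [:g:]"
      by (simp add: varY_def)
    then show ?case
      using add[OF 1 Y[OF pCons.IH]] by metis
  qed (simp add: zero)
  show ?thesis
  proof (induction F)
    case (pCons c g)
    have "pCons c g = [:c:] + varZ * g"
      by (simp add: varZ_def)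
    then show ?case
      using add[OF 2 Z[OF pCons.IH]] by metis
  qed (simp add: zero)
qed

section \<open>Factors of forms and irreducibility after setting \<open>Z = 1\<close>\<close>

text \<open>The substitution \<open>F(XZ, YZ, Z)\<close> turns total degree into degree in \<open>Z\<close>.\<close>
definition total_degree_hom :: "'k::comm_ring_1 poly3 \<Rightarrow> 'k poly3" where
  "total_degree_hom F = subst3 F (varX * varZ) (varY * varZ) varZ"

lemma unital_hom_total_degree_hom: "unital_hom total_degree_hom"
  unfolding total_degree_hom_def[abs_def] by (rule unital_hom_subst3)

text \<open>The monomial \<open>X^i Y^j Z^k\<close> becomes \<open>X^i Y^j Z^(i+j+k)\<close>, so
  distinct monomials stay distinct and \<open>F\<close> can be recovered from its image.\<close>

lemma coeff_total_degree_hom: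
  "coeff (coeff (coeff (total_degree_hom F) m) j) i
    = (if i + j \<le> m then coeff (coeff (coeff F (m - i - j)) j) i else 0)"
proof (induction F arbitrary: i j m rule: poly3_induct)
  interpret unital_hom "total_degree_hom :: 'a poly3 \<Rightarrow> _"
    by (rule unital_hom_total_degree_hom)
  have gens: "total_degree_hom (const3 c) = const3 c" "total_degree_hom varX = varX * varZ"
    "total_degree_hom varY = varY * varZ" "total_degree_hom varZ = varZ" for c :: 'a
    by (simp_all add: total_degree_hom_def)
  {
    case (const c)
    then show ?case
      by (simp add: gens) (auto simp: const3_def coeff_pCons split: nat.splits)
  next
    case (add F G)
    then show ?case by simp
  next
    case (X F)
    show ?case
      by (simp add: gens mult.assoc)
         (auto simp: varX_def varZ_def coeff_pCons X split: nat.splits)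
  next
    case (Y F)
    show ?case
      by (simp add: gens mult.assoc)
         (auto simp: varY_def varZ_def coeff_pCons Y split: nat.splits)
  next
    case (Z F)
    show ?case
      by (simp add: gens) (auto simp: varZ_def coeff_pCons Z Suc_diff_le split: nat.splits)
  }
qed

lemma poly_total_degree_hom_1: "poly (total_degree_hom F) 1 = poly F 1"
  unfolding total_degree_hom_def
  by (subst poly_subst3_1)
     (simp_all add: varX_def varY_def varZ_def eval2_pcompose)

text \<open>Reversing coefficients turns the monomial into a constant, so the reversed
  \<open>A\<close> has degree 0 and only the top term of \<open>A\<close> remains.\<close>

lemma monom_mult_factor:
  fixes A B :: "'a::idom poly"
  assumes "A * B = monom c d" "c \<noteq> 0"
  shows "A = monom (lead_coeff A) (degree A)"
proof (cases "A = 0")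
  case False
  have "reflect_poly (monom c d) = [:c:]"
  proof (rule poly_eqI)
    fix n
    show "coeff (reflect_poly (monom c d)) n = coeff [:c:] n"
      using assms(2) by (cases n) (simp_all add: coeff_reflect_poly degree_monom_eq, linarith)
  qed
  then have "reflect_poly A * reflect_poly B = [:c:]"
    unfolding reflect_poly_mult[symmetric] assms(1) .
  moreover have "reflect_poly B \<noteq> 0"
    using assms by auto
  ultimately have deg: "degree (reflect_poly A) = 0"
    using degree_mult_eq[of "reflect_poly A" "reflect_poly B"] False by simp
  have "coeff A i = coeff (monom (lead_coeff A) (degree A)) i" for i
  proof (cases "i < degree A")
    case True
    then have "coeff A i = coeff (reflect_poly A) (degree A - i)"
      by (simp add: coeff_reflect_poly)
    also have "\<dots> = 0"
      using True deg by (intro coeff_eq_0) simp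
    finally show ?thesis
      using True by simp
  next
    case i: False
    then show ?thesis
      by (cases "i = degree A") (auto simp: coeff_eq_0)
  qed
  then show ?thesis
    by (rule poly_eqI)
qed simp

text \<open>The image of the form \<open>A * B\<close> under \<open>total_degree_hom\<close> is a
  monomial in \<open>Z\<close>, hence that of \<open>A\<close> is some \<open>C Z^a\<close>, with
  \<open>C\<close> constant because \<open>poly A 1\<close> is. So \<open>A = C Z^a\<close>, and
  \<open>a = 0\<close> because \<open>Z\<close> does not divide \<open>A * B\<close>.\<close>

lemma unit_of_unit_dehomogenization:
  fixes A B :: "'k::field poly3"
  assumes F: "plane_curve d (A * B)" "poly (A * B) 0 \<noteq> 0" and "poly A 1 dvd 1"
  shows "A dvd 1"
proof -
  interpret unital_hom "total_degree_hom :: 'k poly3 \<Rightarrow> _"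
    by (rule unital_hom_total_degree_hom)
  obtain c where c: "poly A 1 = [:[:c:]:]" "c dvd 1"
    using assms(3) by (auto simp: is_unit_poly_iff)
  have "coeff (coeff (coeff (total_degree_hom (A * B)) m) j) i
      = coeff (coeff (coeff (monom (poly (A * B) 1) d) m) j) i" for i j m
    unfolding coeff_total_degree_hom using F(1) coeff_dehomogenize[OF F(1), of j i]
    by (fastforce simp: plane_curve_def)
  then have "total_degree_hom A * total_degree_hom B = monom (poly (A * B) 1) d"
    by (simp add: poly_eq_iff)
  then have "\<exists>C a. total_degree_hom A = monom C a"
    using monom_mult_factor dehomogenize_nonzero[OF F(1)] by blast
  then obtain C a where Ca: "total_degree_hom A = monom C a" by blast
  then have "C = [:[:c:]:]"
    using poly_total_degree_hom_1[of A] c(1) by (simp add: poly_monom)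
  have "coeff (coeff (coeff A k) j) i = coeff (coeff (coeff (monom C a) k) j) i" for i j k
  proof -
    have "coeff (coeff (coeff A k) j) i = coeff (coeff (coeff (monom C a) (i + j + k)) j) i"
      using coeff_total_degree_hom[of A "i + j + k" j i] Ca by simp
    then show ?thesis
      by (auto simp: \<open>C = _\<close> coeff_pCons split: nat.splits)
  qed
  then have A: "A = monom C a"
    by (simp add: poly_eq_iff)
  have "a = 0"
    using F(2) by (auto simp: A poly_monom power_0_left split: if_splits)
  then show ?thesis
    using c(2) A by (simp add: \<open>C = _\<close> monom_0 is_unit_const_poly_iff)
qed

text \<open>Setting \<open>Z = 1\<close> can lose only factors \<open>Z\<close>, which
  \<open>poly F 0 \<noteq> 0\<close> excludes.\<close>

lemma irreducible_of_dehomogenization: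
  fixes F :: "'k::field poly3"
  assumes F: "plane_curve d F" "poly F 0 \<noteq> 0" and irr: "irreducible (poly F 1)"
  shows "irreducible F"
proof (rule irreducibleI)
  show "F \<noteq> 0"
    using F by auto
  show "\<not> F dvd 1"
    using unital_hom.unit[OF unital_hom_poly[of 1]] irreducible_not_unit[OF irr] by blast
  fix A B assume AB: "F = A * B"
  then have "poly F 1 = poly A 1 * poly B 1"
    by simp
  from irreducibleD[OF irr this] show "A dvd 1 \<or> B dvd 1"
  proof
    assume "poly A 1 dvd 1"
    then show ?thesis
      using unit_of_unit_dehomogenization[of d A B] F AB by simp
  next
    assume "poly B 1 dvd 1"
    then show ?thesis
      using unit_of_unit_dehomogenization[of d B A] F AB by (simp add: mult.commute)
  qed
qed

section \<open>The Dickson invariant and linear substitutions\<close>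

text \<open>The Dickson invariant of degree \<open>q\<^sup>2 - q\<close> of \<open>GL(2,q)\<close>, which is
  \<open>(u^q\<^sup>2 v - u v^q\<^sup>2) / (u^q v - u v^q)\<close> without division.\<close>
definition dickson :: "nat \<Rightarrow> 'a::comm_ring_1 \<Rightarrow> 'a \<Rightarrow> 'a" where
  "dickson q u v = (v ^ q - v * u ^ (q - 1)) ^ (q - 1) + u ^ (q * (q - 1))"

lemma unital_hom_dickson:
  assumes "unital_hom h"
  shows "h (dickson q u v) = dickson q (h u) (h v)"
proof -
  interpret unital_hom h by fact
  show ?thesis by (simp add: dickson_def)
qed

lemma dickson_eq:
  fixes u v :: "'a::comm_ring_1"
  assumes "q > 0" and frob: "\<And>x y::'a. (x - y) ^ q = x ^ q - y ^ q"
  shows "(u ^ q * v - u * v ^ q) * dickson q u v = (u ^ q) ^ q * v - u * (v ^ q) ^ q"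
proof -
  \<comment> \<open>Now \<open>u^q v - u v^q = - u w\<close>, and the invariant is
    \<open>w^(q-1) + c^q\<close>.\<close>
  define c w where "c = u ^ (q - 1)" and "w = v ^ q - v * c"
  have uq: "u ^ q = u * c"
    using assms(1) by (simp add: c_def flip: power_Suc)
  have wq: "w * w ^ (q - 1) = (v ^ q) ^ q - v ^ q * c ^ q"
    using assms(1) by (simp add: w_def frob power_mult_distrib flip: power_Suc)
  have "u ^ (q * (q - 1)) = c ^ q"
    by (simp add: c_def mult.commute flip: power_mult)
  then have Q: "dickson q u v = w ^ (q - 1) + c ^ q"
    by (simp add: dickson_def w_def c_def)
  have "(u ^ q * v - u * v ^ q) * dickson q u v = - u * (w * w ^ (q - 1)) - u * w * c ^ q"
    unfolding Q uq by (simp add: w_def algebra_simps)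
  also have "\<dots> = (u * c) ^ q * v - u * (v ^ q) ^ q"
    unfolding wq by (simp add: w_def power_mult_distrib uq algebra_simps)
  finally show ?thesis
    by (simp add: uq)
qed

text \<open>Both sides of \<open>dickson_eq\<close> are determinants in \<open>u\<close>, \<open>v\<close> and their conjugates.\<close>
lemma dickson_linear:
  fixes u v :: "'a::idom"
  assumes "q > 0" and frob: "\<And>x y::'a. (x + y) ^ q = x ^ q + y ^ q"
      "\<And>x y::'a. (x - y) ^ q = x ^ q - y ^ q"
    and fixed: "a ^ q = a" "b ^ q = b" "a' ^ q = a'" "b' ^ q = b'"
    and "a * b' - b * a' \<noteq> 0" and indep: "u ^ q * v - u * v ^ q \<noteq> 0"
  shows "dickson q (a * u + b * v) (a' * u + b' * v) = dickson q u v"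
proof -
  define U V where "U = a * u + b * v" and "V = a' * u + b' * v"
  have q1: "U ^ q = a * u ^ q + b * v ^ q" "V ^ q = a' * u ^ q + b' * v ^ q"
    by (simp_all add: U_def V_def frob power_mult_distrib fixed)
  then have q2: "(U ^ q) ^ q = a * (u ^ q) ^ q + b * (v ^ q) ^ q"
      "(V ^ q) ^ q = a' * (u ^ q) ^ q + b' * (v ^ q) ^ q"
    by (simp_all add: frob power_mult_distrib fixed)
  \<comment> \<open>Both determinants are multiplied by \<open>a * b' - b * a'\<close>, so their
    quotient does not change.\<close>
  have L: "U ^ q * V - U * V ^ q = (a * b' - b * a') * (u ^ q * v - u * v ^ q)"
    by (simp add: q1, simp add: U_def V_def algebra_simps)
  have "(U ^ q * V - U * V ^ q) * dickson q U V = (U ^ q) ^ q * V - U * (V ^ q) ^ q"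
    by (rule dickson_eq[OF assms(1) frob(2)])
  also have "\<dots> = (a * b' - b * a') * ((u ^ q) ^ q * v - u * (v ^ q) ^ q)"
    unfolding q2 by (simp add: U_def V_def algebra_simps)
  also have "\<dots> = (U ^ q * V - U * V ^ q) * dickson q u v"
    by (simp only: L mult.assoc dickson_eq[OF assms(1) frob(2)])
  finally show ?thesis
    using assms(8) indep by (simp add: L flip: U_def V_def)
qed

section \<open>Irreducibility of the affine curve\<close>

context closed_char
begin

section \<open>The curves \<open>branch b\<close> and their parametrisations\<close>

abbreviation art :: "'k poly" where "art \<equiv> monom 1 q - [:0, 1:]"

abbreviation u2 :: "'k poly poly" where "u2 \<equiv> [:art:]"
abbreviation v2 :: "'k poly poly" where "v2 \<equiv> monom 1 q - [:0, 1:]"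

text \<open>These are the elements of \<open>F\<^bsub>q\<^sup>2\<^esub>\<close> outside \<open>F\<^sub>q\<close>.\<close>
definition conj_roots :: "'k set" where
  "conj_roots = {b. (b ^ q - b) ^ (q - 1) = - 1}"

lemma conj_rootsD:
  assumes "b \<in> conj_roots"
  shows "b ^ q - b \<noteq> 0" "(b ^ q) ^ q = b"
proof -
  show nz: "b ^ q - b \<noteq> 0"
    using assms q_ge_2 by (auto simp: conj_roots_def power_0_left)
  have "(b ^ q - b) ^ q = (b ^ q - b) ^ (q - 1) * (b ^ q - b)"
    using q_ge_2 by (simp flip: power_Suc2)
  also have "\<dots> = b - b ^ q"
    using assms by (simp add: conj_roots_def)
  finally show "(b ^ q) ^ q = b"
    by (simp add: frobK)
qed

lemma card_conj_roots: "card conj_roots = q * (q - 1)"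
  using card_frobenius_diff_roots by (simp add: conj_roots_def)

lemma finite_conj_roots: "finite conj_roots"
  using card_conj_roots q_ge_2 by (intro card_ge_0_finite) simp

text \<open>Solving \<open>s = y - b x\<close>, \<open>t = y - b^q x\<close> gives
  \<open>x = (s - t) / (b^q - b)\<close> and \<open>y = b^q x + t\<close>; on the branch
  \<open>s = t^q\<close>.\<close>

definition parX :: "'k \<Rightarrow> 'k poly" where
  "parX b = smult (1 / (b ^ q - b)) art"

definition parY :: "'k \<Rightarrow> 'k poly" where
  "parY b = smult (b ^ q) (parX b) + [:0, 1:]"

text \<open>Restriction to the curve \<open>branch b\<close>, which is parametrised by polynomials.\<close>
definition par :: "'k \<Rightarrow> 'k poly poly \<Rightarrow> 'k poly" where
  "par b = eval2 (\<lambda>c. [:c:]) (parX b) (parY b)"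

lemma unital_hom_par: "unital_hom (par b)"
  unfolding par_def by (intro unital_hom_eval2 unital_hom_const)

lemma par_gens: "par b [:[:c:]:] = [:c:]" "par b [:[:0, 1:]:] = parX b" "par b [:0, 1:] = parY b"
  by (simp_all add: par_def unital_hom_const)

lemma x_power: "[:0, 1::'a::comm_ring_1:] ^ m = monom 1 m"
  by (simp add: monom_altdef)

lemma u2_eq: "u2 = [:[:0, 1:]:] ^ q - [:[:0, 1:]:]"
  by (simp add: poly_const_pow x_power)

lemma v2_eq: "v2 = [:0, 1:] ^ q - [:0, 1:]"
  by (simp add: x_power)

lemma par_u2: "par b u2 = parX b ^ q - parX b"
proof -
  interpret unital_hom "par b" by (rule unital_hom_par)
  show ?thesis unfolding u2_eq by (simp only: diff power par_gens)
qed

text \<open>From \<open>y = b^q x + t\<close> and \<open>(b^q)^q = b\<close> one gets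
  \<open>y^q - y = b x^q - b^q x + t^q - t\<close>, where
  \<open>t^q - t = (b^q - b) x\<close>.\<close>

lemma par_v2:
  assumes "b \<in> conj_roots"
  shows "par b v2 = smult b (parX b ^ q - parX b)"
proof -
  interpret unital_hom "par b" by (rule unital_hom_par)
  have X: "smult (b ^ q - b) (parX b) = art"
    using conj_rootsD[OF assms] by (simp add: parX_def)
  have "par b v2 = parY b ^ q - parY b"
    unfolding v2_eq by (simp only: diff power par_gens)
  also have "\<dots> = smult b (parX b ^ q) - smult (b ^ q) (parX b) + art"
    by (simp add: parY_def frobKx smult_power conj_rootsD[OF assms] x_power)
  also have "\<dots> = smult b (parX b ^ q - parX b)"
    unfolding X[symmetric] by (simp add: smult_diff_left smult_diff_right)
  finally show ?thesis .
qed

text \<open>In \<open>t\<close>, \<open>parX b\<close> has degree \<open>q\<close> and its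
  \<open>q\<close>-th power degree \<open>q^2\<close>. With \<open>par_branch\<close> this shows
  that no other branch equation vanishes on \<open>branch b\<close>.\<close>

lemma parX_frob_nonzero:
  assumes "b \<in> conj_roots"
  shows "parX b ^ q - parX b \<noteq> 0"
proof
  assume "parX b ^ q - parX b = 0"
  then have "degree (parX b ^ q) = degree (parX b)"
    by simp
  moreover have "degree (parX b) = q"
    using conj_rootsD[OF assms] by (simp add: parX_def degree_artin_schreier)
  moreover from this have "parX b \<noteq> 0"
    using q_ge_2 by auto
  ultimately show False
    using q_ge_2 by (auto simp: degree_power_eq)
qed

text \<open>These are the linear factors \<open>v - b u\<close> of the Dickson invariant, taken at
  \<open>u2\<close> and \<open>v2\<close>.\<close>

definition branch :: "'k \<Rightarrow> 'k poly poly" where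
  "branch b = v2 - smult [:b:] u2"

lemma par_branch:
  assumes "b \<in> conj_roots"
  shows "par b (branch c) = smult (b - c) (parX b ^ q - parX b)"
proof -
  interpret unital_hom "par b" by (rule unital_hom_par)
  have "branch c = v2 - [:[:c:]:] * u2"
    by (simp add: branch_def)
  then have "par b (branch c) = par b v2 - par b [:[:c:]:] * par b u2"
    by (simp only: diff mult)
  also have "\<dots> = smult (b - c) (parX b ^ q - parX b)"
    by (simp only: par_u2 par_v2[OF assms] par_gens) (simp add: smult_diff_left)
  finally show ?thesis .
qed

lemma degree_v2: "degree v2 = q" "lead_coeff v2 = 1"
  by (simp_all add: degree_artin_schreier) (use q_ge_2 in \<open>auto simp: coeff_pCons split: nat.splits\<close>)

lemma degree_branch: "degree (branch b) = q" "branch b \<noteq> 0"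
proof -
  show "degree (branch b) = q"
    unfolding branch_def using q_ge_2
    by (subst diff_conv_add_uminus, subst degree_add_eq_left) (simp_all add: degree_artin_schreier)
  then show "branch b \<noteq> 0"
    using q_ge_2 by auto
qed

text \<open>In the coordinates \<open>s = y - bx\<close>, \<open>t = y - b\<^sup>q x\<close> the branch is \<open>t\<^sup>q - s\<close>, so modulo it
  every polynomial in \<open>x\<close>, \<open>y\<close> becomes a polynomial in \<open>t\<close>.\<close>
lemma branch_dvd:
  assumes b: "b \<in> conj_roots" and g: "par b P = [:g:]"
  shows "branch b dvd P - [:[:g:]:]"
proof -
  define cst where "cst = (\<lambda>c::'k. [:[:c:]:])"
  have cst: "unital_hom cst"
    unfolding cst_def by (rule unital_hom_const2)
  interpret cst: unital_hom cst by (rule cst)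
  define X Y :: "'k poly poly" where "X = [:[:0, 1:]:]" and "Y = [:0, 1:]"
  define b' where "b' = cst (b ^ q)"
  define t where "t = Y - b' * X"
  \<comment> \<open>\<open>at_t\<close> puts \<open>t = y - b^q x\<close> back into a polynomial in
    the parameter.\<close>
  define at_t where "at_t = (\<lambda>h. poly (map_poly cst h) t)"
  have at_t: "unital_hom at_t"
    unfolding at_t_def by (rule cst.eval)
  interpret at_t: unital_hom at_t by (rule at_t)
  have at_t_gens: "at_t [:c:] = cst c" "at_t [:0, 1:] = t" for c
    by (simp_all add: at_t_def)
  have smult_at_t: "at_t (smult c h) = cst c * at_t h" for c h
    using at_t.mult[of "[:c:]" h] by (simp add: at_t_gens)
  define c where "c = b ^ q - b"
  have "c \<noteq> 0" "(b ^ q) ^ q = b"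
    using conj_rootsD[OF b] by (simp_all add: c_def)
  define X' Y' where "X' = at_t (parX b)" and "Y' = at_t (parY b)"
  have "at_t art = t ^ q - t"
    using at_t_gens at_t.diff at_t.power by (metis x_power)
  then have X': "X' = cst (1 / c) * (t ^ q - t)"
    by (simp add: X'_def parX_def smult_at_t c_def)
  have Y': "Y' = b' * X' + t"
    by (simp add: b'_def Y'_def X'_def parY_def smult_at_t at_t_gens)
  have tq: "t ^ q = Y ^ q - cst b * X ^ q"
    by (simp add: t_def b'_def frobKxy power_mult_distrib \<open>(b ^ q) ^ q = b\<close> flip: cst.power)
  have cc: "cst c = b' - cst b"
    by (simp add: c_def b'_def)
  have br: "branch b = (Y ^ q - Y) - cst b * (X ^ q - X)"
    unfolding branch_def u2_eq v2_eq X_def Y_def cst_def by simp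
  \<comment> \<open>Modulo the branch, \<open>c x\<close> is \<open>t^q - t\<close>, so
    \<open>x\<close> and \<open>y\<close> are congruent to their parametrised values
    \<open>X'\<close> and \<open>Y'\<close>.\<close>
  have "cst c * X - (t ^ q - t) = - branch b"
    unfolding tq cc br by (simp add: t_def algebra_simps)
  moreover have c1: "cst (1 / c) * cst c = 1"
    using \<open>c \<noteq> 0\<close> by (simp flip: cst.mult)
  moreover have "X - X' = (cst (1 / c) * cst c) * X - X'"
    by (simp only: c1 mult_1)
  then have "X - X' = cst (1 / c) * (cst c * X - (t ^ q - t))"
    unfolding X' by (simp only: right_diff_distrib mult.assoc)
  ultimately have "X - X' = branch b * (- cst (1 / c))"
    by simp
  then have dX: "branch b dvd X - X'"
    by (metis dvd_triv_left)
  have "Y - Y' = b' * (X - X')"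
    unfolding Y' by (simp add: t_def algebra_simps)
  then have dY: "branch b dvd Y - Y'"
    using dX by simp
  \<comment> \<open>The first value is \<open>P\<close> itself, the second is \<open>par b P\<close>
    taken at \<open>t\<close>, which is the constant \<open>g\<close>.\<close>
  have "branch b dvd eval2 cst X Y P - eval2 cst X' Y' P"
    by (rule dvd_eval2_diff[OF cst dX dY])
  moreover have "eval2 cst X Y P = P"
    using eval2_pcompose[of Y P] by (simp add: cst_def X_def Y_def)
  moreover have "eval2 cst X' Y' P = at_t (par b P)"
    by (rule unital_hom_poly2_eqI[of "eval2 cst X' Y'" "\<lambda>P. at_t (par b P)"])
       (auto intro!: unital_hom_eval2 cst unital_hom_comp[OF at_t unital_hom_par]
          simp: cst par_gens at_t_gens X'_def Y'_def)
  ultimately show ?thesis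
    by (simp add: g at_t_gens) (simp add: cst_def)
qed

text \<open>After splitting off \<open>branch b\<close>, its restriction to any other branch is a
  nonzero element of the domain \<open>K[t]\<close>, so the cofactor still vanishes on the remaining
  branches.\<close>

lemma prod_branch_dvd:
  assumes "finite B" "B \<subseteq> conj_roots" "\<And>b. b \<in> B \<Longrightarrow> par b P = 0"
  shows "(\<Prod>b\<in>B. branch b) dvd P"
  using assms
proof (induction B arbitrary: P rule: finite_induct)
  case (insert b B)
  have "branch b dvd P - [:[:0:]:]"
    using insert.prems by (intro branch_dvd) auto
  then obtain R where R: "P = branch b * R"
    by auto
  have "par b' R = 0" if b': "b' \<in> B" for b'
  proof -
    interpret unital_hom "par b'" by (rule unital_hom_par)
    have "par b' (branch b) * par b' R = 0"
      using insert.prems(2)[of b'] b' R by simp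
    moreover have "b' \<in> conj_roots" "b' \<noteq> b"
      using insert b' by auto
    ultimately show ?thesis
      using parX_frob_nonzero by (auto simp: par_branch)
  qed
  then have "(\<Prod>b\<in>B. branch b) dvd R"
    using insert.IH insert.prems by auto
  then show ?case
    using insert.hyps R by (simp add: mult_dvd_mono)
qed simp

section \<open>The affine equation \<open>f\<close> and its irreducibility\<close>

definition affine_dgz :: "'k poly poly" where
  "affine_dgz = dickson q u2 v2 + 1"

text \<open>On \<open>branch b\<close> the invariant is taken at \<open>(w, b w)\<close>, where it
  equals \<open>w^(q (q-1)) ((b^q - b)^(q-1) + 1) = 0\<close>.\<close>

lemma par_affine_dgz:
  assumes "b \<in> conj_roots"
  shows "par b affine_dgz = 1"
proof -
  interpret unital_hom "par b" by (rule unital_hom_par)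
  define w where "w = parX b ^ q - parX b"
  have "dickson q w (smult b w) = (smult (b ^ q - b) (w ^ q)) ^ (q - 1) + w ^ (q * (q - 1))"
    using q_ge_2 by (simp add: dickson_def smult_power smult_diff_left flip: power_Suc)
  also have "\<dots> = 0"
    using assms by (simp add: conj_roots_def smult_power power_mult)
  finally have "dickson q w (smult b w) = 0" .
  moreover have "par b affine_dgz = dickson q (par b u2) (par b v2) + 1"
    by (simp only: affine_dgz_def add one unital_hom_dickson[OF unital_hom_par])
  ultimately show ?thesis
    by (simp only: par_u2 par_v2[OF assms] w_def add_0)
qed

text \<open>The degree is that in \<open>y\<close> over \<open>K[x]\<close>; the term
  \<open>v2^q\<close>, raised to the power \<open>q - 1\<close>, dominates.\<close>

lemma degree_affine_dgz: "degree affine_dgz = q ^ 2 * (q - 1)" "lead_coeff affine_dgz = 1"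
proof -
  define w where "w = v2 ^ q - v2 * u2 ^ (q - 1)"
  have "degree (v2 * u2 ^ (q - 1)) \<le> q"
    using degree_mult_le[of v2 "u2 ^ (q - 1)"] degree_v2
    by (simp add: poly_const_pow)
  moreover have dv: "degree (v2 ^ q) = q * q"
    using degree_v2 q_ge_2 by (metis degree_power_eq leading_coeff_0_iff one_neq_zero mult.commute)
  moreover have "q < q * q"
    using q_ge_2 by simp
  ultimately have less: "degree (- (v2 * u2 ^ (q - 1))) < degree (v2 ^ q)"
    by (simp only: degree_minus dv)
  have w_eq: "w = - (v2 * u2 ^ (q - 1)) + v2 ^ q"
    by (simp add: w_def)
  have w: "degree w = q * q" "lead_coeff w = 1"
    unfolding w_eq
    by (simp only: degree_add_eq_right[OF less] dv)
       (simp only: lead_coeff_add_le[OF less] lead_coeff_power degree_v2(2) power_one)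
  then have "w \<noteq> 0"
    by auto
  then have wp: "degree (w ^ (q - 1)) = q ^ 2 * (q - 1)" "lead_coeff (w ^ (q - 1)) = 1"
    by (simp add: degree_power_eq w(1) power2_eq_square)
       (simp only: lead_coeff_power w(2) power_one)
  have eq: "affine_dgz = [:art ^ (q * (q - 1)) + 1:] + w ^ (q - 1)"
    by (simp add: affine_dgz_def dickson_def w_def poly_const_pow one_pCons[where 'a = "'k poly"])
  have less: "degree [:art ^ (q * (q - 1)) + 1:] < degree (w ^ (q - 1))"
    using wp q_ge_2 by simp
  show "degree affine_dgz = q ^ 2 * (q - 1)" "lead_coeff affine_dgz = 1"
    unfolding eq
    by (simp only: degree_add_eq_right[OF less] wp(1))
       (simp only: lead_coeff_add_le[OF less] wp(2))
qed

lemma irreducible_affine_dgz: "irreducible affine_dgz"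
proof (rule irreducibleI)
  have deg: "degree affine_dgz > 0"
    using degree_affine_dgz q_ge_2 by simp
  then show "affine_dgz \<noteq> 0" "\<not> affine_dgz dvd 1"
    by (auto simp: is_unit_poly_iff)
  fix P R assume PR: "affine_dgz = P * R"
  have "P \<noteq> 0" "R \<noteq> 0"
    using PR deg by auto
  define p0 where "p0 = coeff (coeff P 0) 0"
  have par_P: "par b P = [:p0:]" if b: "b \<in> conj_roots" for b
  proof -
    interpret unital_hom "par b" by (rule unital_hom_par)
    have "par b P * par b R = 1"
      using par_affine_dgz[OF b] PR by simp
    then have "par b P dvd 1"
      by (metis dvd_triv_left)
    then obtain g where g: "par b P = [:g:]"
      by (auto simp: is_unit_poly_iff)
    \<comment> \<open>The parameter \<open>t = 0\<close> gives the origin on every branch, so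
      \<open>g\<close> is \<open>P(0,0)\<close>.\<close>
    have "poly (parX b) 0 = 0" "poly (parY b) 0 = 0"
      using q_ge_2 by (simp_all add: parX_def parY_def poly_monom power_0_left)
    then have "poly (par b P) 0 = poly (poly P 0) 0"
      by - (rule unital_hom_poly2_eqI[of "\<lambda>P. poly (par b P) 0" "\<lambda>P. poly (poly P 0) 0",
            OF unital_hom_comp[OF unital_hom_poly unital_hom_par]
              unital_hom_comp[OF unital_hom_poly unital_hom_poly]], simp_all add: par_gens)
    then show ?thesis
      using g by (simp add: p0_def poly_0_coeff_0)
  qed
  have dvd: "(\<Prod>b\<in>conj_roots. branch b) dvd P - [:[:p0:]:]"
  proof (rule prod_branch_dvd[OF finite_conj_roots order_refl])
    fix b assume "b \<in> conj_roots"
    then show "par b (P - [:[:p0:]:]) = 0"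
      using par_P unital_hom.diff[OF unital_hom_par] by (simp add: par_gens)
  qed
  show "P dvd 1 \<or> R dvd 1"
  proof (cases "P = [:[:p0:]:]")
    case True
    then show ?thesis
      using \<open>P \<noteq> 0\<close> by (auto simp: is_unit_const_poly_iff dvd_field_iff)
  next
    case False
    \<comment> \<open>There are \<open>q (q - 1)\<close> branches of degree \<open>q\<close> in
      \<open>y\<close>, so \<open>P\<close> takes up the whole degree of
      \<open>affine_dgz\<close>.\<close>
    have "degree (\<Prod>b\<in>conj_roots. branch b) = q ^ 2 * (q - 1)"
      by (simp add: degree_prod_eq_sum_degree degree_branch card_conj_roots power2_eq_square)
    then have "q ^ 2 * (q - 1) \<le> degree (P - [:[:p0:]:])"
      using dvd_imp_degree_le[OF dvd] False by simp
    also have "\<dots> \<le> degree P"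
      by (intro degree_diff_le) auto
    finally have "degree R = 0"
      using degree_affine_dgz(1) \<open>P \<noteq> 0\<close> \<open>R \<noteq> 0\<close> by (simp add: PR degree_mult_eq)
    then obtain r where r: "R = [:r:]"
      by (auto elim: degree_eq_zeroE)
    \<comment> \<open>So far \<open>R\<close> only lies in \<open>K[x]\<close>; it is a unit because
      \<open>affine_dgz\<close> is monic in \<open>y\<close>.\<close>
    have "lead_coeff P * r = 1"
      using degree_affine_dgz(2) \<open>R \<noteq> 0\<close> by (simp add: PR r mult.commute)
    then have "r dvd 1"
      by (metis dvd_triv_right)
    then show ?thesis
      by (simp add: r is_unit_const_poly_iff)
  qed
qed

end

section \<open>The Dickson-Guralnick-Zieve curve\<close>

context closed_char
begin

text \<open>The homogenization of \<open>affine_dgz\<close>.\<close>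

definition dgz :: "'k poly3" where
  "dgz = dickson q (varX ^ q - varX * varZ ^ (q - 1)) (varY ^ q - varY * varZ ^ (q - 1))
    + varZ ^ (q ^ 2 * (q - 1))"

lemma homog_dgz: "homog (q ^ 2 * (q - 1)) dgz"
proof -
  have q: "Suc (q - 1) = q"
    using q_ge_2 by simp
  have *: "homog q (x ^ q - x * varZ ^ (q - 1))" if x: "homog 1 x" for x :: "'k poly3"
  proof (rule homog_diff)
    show "homog q (x ^ q)"
      using homog_power[OF x, of q] by simp
    show "homog q (x * varZ ^ (q - 1))"
      using homog_mult[OF x homog_power[OF homog_vars(3), of "q - 1"]] q by simp
  qed
  define u v :: "'k poly3"
    where "u = varX ^ q - varX * varZ ^ (q - 1)" and "v = varY ^ q - varY * varZ ^ (q - 1)"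
  have u: "homog q u" and v: "homog q v"
    unfolding u_def v_def by (intro * homog_vars)+
  have "homog (q * q) (v * u ^ (q - 1))"
    using homog_mult[OF v homog_power[OF u, of "q - 1"]] q by (metis mult_Suc_right)
  then have "homog (q * q * (q - 1)) ((v ^ q - v * u ^ (q - 1)) ^ (q - 1))"
    by (intro homog_power homog_diff v)
  then have "homog (q ^ 2 * (q - 1)) (dickson q u v)"
    unfolding dickson_def
    using homog_power[OF u, of "q * (q - 1)"] by (simp add: power2_eq_square mult.assoc homog_add)
  moreover have "homog (q ^ 2 * (q - 1)) (varZ ^ (q ^ 2 * (q - 1)) :: 'k poly3)"
    using homog_power[OF homog_vars(3), of "q ^ 2 * (q - 1)"] by (simp only: mult_1)
  ultimately show ?thesis
    unfolding dgz_def u_def v_def by (rule homog_add)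
qed

lemma poly_dgz_1: "poly dgz 1 = affine_dgz"
proof -
  interpret unital_hom "\<lambda>F::'k poly3. poly F 1"
    by (rule unital_hom_poly)
  have "poly varX 1 = [:[:0, 1::'k:]:]" "poly varY 1 = [:0, 1::'k poly:]" "poly varZ 1 = (1::'k poly poly)"
    by (simp_all add: varX_def varY_def varZ_def)
  then show ?thesis
    unfolding dgz_def affine_dgz_def u2_eq v2_eq
    by (simp only: add unital_hom_dickson[OF unital_hom_poly] diff power mult power_one mult_1_right)
qed

lemma plane_curve_dgz: "plane_curve (q ^ 3 - q ^ 2) dgz"
proof -
  have "q ^ 3 - q ^ 2 = q ^ 2 * (q - 1)"
    by (simp add: power3_eq_cube power2_eq_square algebra_simps)
  moreover have "dgz \<noteq> 0"
    using poly_dgz_1 irreducible_affine_dgz by auto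
  ultimately show ?thesis
    using homog_dgz q_ge_2 by (simp add: plane_curve_def homog_def)
qed

lemma dickson_at_infinity:
  "poly (varX ^ q - varX * varZ ^ (q - 1)) 0 = [:monom (1::'k) q:]"
  "poly (varY ^ q - varY * varZ ^ (q - 1)) 0 = monom (1::'k poly) q"
  using q_ge_2
  by (simp_all add: varX_def varY_def varZ_def power_0_left poly_const_pow x_power poly_monom)

text \<open>At \<open>Z = 0\<close> and \<open>Y = 0\<close> only a power of \<open>X\<close> is
  left. Hence \<open>Z\<close> does not divide \<open>dgz\<close>.\<close>

lemma poly_dgz_0: "poly dgz 0 \<noteq> 0"
proof -
  interpret unital_hom "\<lambda>F::'k poly3. poly F 0"
    by (rule unital_hom_poly)
  have "poly dgz 0 = dickson q [:monom 1 q:] (monom 1 q)"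
    unfolding dgz_def using q_ge_2
    by (simp only: add unital_hom_dickson[OF unital_hom_poly] dickson_at_infinity)
       (simp add: varZ_def power_0_left)
  moreover have "poly (dickson q [:monom (1::'k) q:] (monom 1 q)) 0 \<noteq> 0"
    using q_ge_2
    by (simp only: unital_hom_dickson[OF unital_hom_poly])
       (simp add: dickson_def poly_monom power_0_left)
  ultimately show ?thesis
    by auto
qed

lemma irreducible_dgz: "irreducible dgz"
  using irreducible_of_dehomogenization[OF plane_curve_dgz poly_dgz_0]
    irreducible_affine_dgz poly_dgz_1 by simp

text \<open>The map \<open>L \<mapsto> L^q - L Z^(q-1)\<close> is linear over \<open>F_q\<close> and
  kills \<open>Z\<close>, so a matrix acts on the pair \<open>u\<close>, \<open>v\<close> through
  its upper left 2 by 2 block, which fixes the Dickson invariant. The scaling \<open>l\<close> of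
  \<open>Z\<close> drops out since \<open>l^(q-1) = 1\<close>.\<close>

lemma AGL_invariant_dgz: "AGL_invariant q dgz"
  unfolding AGL_invariant_def
proof (intro allI impI)
  fix M :: "nat \<Rightarrow> nat \<Rightarrow> 'k"
  assume M: "AGL_mat q M"
  have fixed: "const3 (M i j) ^ q = const3 (M i j)" if "i < 3" "j < 3" for i j
    using M that unital_hom.power[OF unital_hom_const3, of "M i j" q]
    by (simp add: AGL_mat_def in_Fq_def)
  have det: "(M 0 0 * M 1 1 - M 0 1 * M 1 0) * M 2 2 \<noteq> 0" and low: "M 2 0 = 0" "M 2 1 = 0"
    using M by (auto simp: AGL_mat_def det3_def algebra_simps)
  define l where "l = const3 (M 2 2)"
  interpret c: unital_hom "const3 :: 'k \<Rightarrow> _"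
    by (rule unital_hom_const3)
  have const3_0: "const3 x = 0 \<longleftrightarrow> x = 0" for x :: 'k
    by (simp add: const3_def)
  have "l \<noteq> 0"
    using det by (simp add: l_def const3_0)
  moreover have "l * l ^ (q - 1) = l * 1"
    using fixed[of 2 2] q_ge_2 by (simp add: l_def flip: power_Suc)
  ultimately have l: "l ^ (q - 1) = 1"
    by simp
  have lin: "lin_subst M F = subst3 F
      (const3 (M 0 0) * varX + const3 (M 0 1) * varY + const3 (M 0 2) * varZ)
      (const3 (M 1 0) * varX + const3 (M 1 1) * varY + const3 (M 1 2) * varZ) (l * varZ)" for F
    using low by (simp add: lin_subst_def l_def)
  interpret s: unital_hom "lin_subst M"
    unfolding lin_subst_def[abs_def] by (rule unital_hom_subst3)
  define u v :: "'k poly3"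
    where "u = varX ^ q - varX * varZ ^ (q - 1)" and "v = varY ^ q - varY * varZ ^ (q - 1)"
  have image: "(a * varX + b * varY + c * varZ) ^ q - (a * varX + b * varY + c * varZ) * (l * varZ) ^ (q - 1)
      = a * u + b * v"
    if "a ^ q = a" "b ^ q = b" "c ^ q = c" for a b c :: "'k poly3"
  proof -
    have z: "varZ ^ q = varZ * varZ ^ (q - 1)"
      using q_ge_2 by (simp flip: power_Suc)
    show ?thesis
      unfolding frobKxyz power_mult_distrib that l u_def v_def mult_1 z by (simp add: algebra_simps)
  qed
  have gens: "lin_subst M varX = const3 (M 0 0) * varX + const3 (M 0 1) * varY + const3 (M 0 2) * varZ"
    "lin_subst M varY = const3 (M 1 0) * varX + const3 (M 1 1) * varY + const3 (M 1 2) * varZ"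
    "lin_subst M varZ = l * varZ"
    by (simp_all only: lin subst3_gens)
  have su: "lin_subst M u = const3 (M 0 0) * u + const3 (M 0 1) * v"
    by (subst u_def, simp only: s.diff s.power s.mult gens) (rule image; simp add: fixed)
  have sv: "lin_subst M v = const3 (M 1 0) * u + const3 (M 1 1) * v"
    by (subst v_def, simp only: s.diff s.power s.mult gens) (rule image; simp add: fixed)
  have indep: "u ^ q * v - u * v ^ q \<noteq> 0"
  proof -
    \<comment> \<open>At \<open>Z = 0\<close> this is \<open>X^(q^2) Y^q - X^q Y^(q^2)\<close>,
      whose coefficient of \<open>Y^q\<close> is nonzero.\<close>
    have "poly (u ^ q * v - u * v ^ q) 0
        = smult (monom 1 q ^ q) (monom 1 q) - smult (monom 1 q) (monom 1 (q * q))"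
      using dickson_at_infinity
      by (simp add: u_def v_def poly_const_pow monom_power)
    moreover have "coeff \<dots> q \<noteq> 0"
      using q_ge_2 by (simp add: monom_power)
    ultimately show ?thesis
      by (metis coeff_0 poly_0)
  qed
  have "lin_subst M (dickson q u v) = dickson q u v"
    unfolding unital_hom_dickson[OF s.unital_hom_axioms] su sv
  proof (rule dickson_linear[OF _ frobKxyz fixed fixed fixed fixed _ indep])
    have "const3 (M 0 0 * M 1 1 - M 0 1 * M 1 0) \<noteq> 0"
      unfolding const3_0 using det by auto
    then show "const3 (M 0 0) * const3 (M 1 1) - const3 (M 0 1) * const3 (M 1 0) \<noteq> 0"
      by simp
  qed (use q_ge_2 in auto)
  moreover have "l ^ (q ^ 2 * (q - 1)) = 1"
    using l by (metis mult.commute power_mult power_one)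
  ultimately have "lin_subst M dgz = dgz"
    unfolding dgz_def u_def[symmetric] v_def[symmetric]
    by (simp only: s.add s.power gens power_mult_distrib mult_1)
  then show "\<exists>c. c \<noteq> 0 \<and> lin_subst M dgz = const3 c * dgz"
    by (intro exI[of _ 1]) simp
qed

end

theorem mainTheorem1:
  fixes p q :: nat
  assumes "prime p"
    and "\<exists>n>0. q = p ^ n"
    and "of_nat p = (0::'k::field)"
    and "\<forall>f::'k poly. degree f > 0 \<longrightarrow> (\<exists>x. poly f x = 0)"
    and "\<forall>x::'k. \<exists>n>0. x ^ (p ^ n) = x"
  shows "(\<forall>(F::'k poly3) d. plane_curve d F \<and> irreducible F \<and> d \<noteq> 1 \<and> AGL_invariant q F
            \<longrightarrow> q ^ 3 - q ^ 2 \<le> d)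
       \<and> (\<exists>F::'k poly3. plane_curve (q ^ 3 - q ^ 2) F \<and> irreducible F \<and> AGL_invariant q F)"
proof -
  obtain n where "n > 0" "q = p ^ n"
    using assms(2) by blast
  then interpret closed_char p q n "TYPE('k)"
    using assms by unfold_locales auto
  show ?thesis
    using AGL_invariant_degree_ge plane_curve_dgz irreducible_dgz AGL_invariant_dgz by blast
qed

end
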